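(* For every $n\ge 2$, $\chi'_<(D_n)>2^{n-2}$.
   Context: Edge-ordered graph: finite simple graph with a linear order on its edges; isomorphisms preserve order; subgraphs carry the induced order. A simple graph can avoid $H$ if some edge-ordering of it has no subgraph isomorphic to $H$. The order chromatic number $\chi'_<(H)$ is the least chromatic number of a finite simple graph that cannot avoid $H$ ($\infty$ if none). For $n\ge2$, $D_n$ is the edge-ordered graph on vertices $x_1,\dots,x_n$ whose edges are the $2n-3$ pairs incident to $x_1$ or $x_n$, ordered as $x_1x_2<x_1x_3<\cdots<x_1x_n<x_2x_n<\cdots<x_{n-1}x_n$. *)

theory Defs
  imports Main "HOL-Library.Extended_Nat"
begin

record 'a sgraph =
  verts :: "'a set"
  edges :: "'a set set"

record 'a eograph = "'a sgraph" +
  eord :: "('a set \<times> 'a set) set"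

definition simple_graph :: "('a, 'm) sgraph_scheme \<Rightarrow> bool" where
  "simple_graph G \<longleftrightarrow> finite (verts G) \<and> (\<forall>e\<in>edges G. e \<subseteq> verts G \<and> card e = 2)"

text \<open>The order \<open>eord G\<close> is the reflexive one: \<open>(d, e) \<in> eord G\<close> means \<open>d \<le> e\<close>.\<close>

definition edge_ordered_graph :: "'a eograph \<Rightarrow> bool" where
  "edge_ordered_graph G \<longleftrightarrow> simple_graph G \<and> linear_order_on (edges G) (eord G)"

definition eo_subgraph :: "'a eograph \<Rightarrow> 'a eograph \<Rightarrow> bool" where
  "eo_subgraph S G \<longleftrightarrow> edge_ordered_graph S \<and> verts S \<subseteq> verts G \<and> edges S \<subseteq> edges G \<and>
     eord S = eord G \<inter> edges S \<times> edges S"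

definition eo_isomorphic :: "'a eograph \<Rightarrow> 'b eograph \<Rightarrow> bool" where
  "eo_isomorphic G H \<longleftrightarrow> (\<exists>f. bij_betw f (verts G) (verts H) \<and>
     (\<forall>u\<in>verts G. \<forall>v\<in>verts G. {u, v} \<in> edges G \<longleftrightarrow> {f u, f v} \<in> edges H) \<and>
     (\<forall>d\<in>edges G. \<forall>e\<in>edges G. (d, e) \<in> eord G \<longleftrightarrow> (f ` d, f ` e) \<in> eord H))"

definition can_avoid :: "'a sgraph \<Rightarrow> 'b eograph \<Rightarrow> bool" where
  "can_avoid G H \<longleftrightarrow> (\<exists>r. linear_order_on (edges G) r \<and>
     \<not> (\<exists>S. eo_subgraph S \<lparr>verts = verts G, edges = edges G, eord = r\<rparr> \<and> eo_isomorphic S H))"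

definition proper_coloring :: "('a, 'm) sgraph_scheme \<Rightarrow> nat \<Rightarrow> ('a \<Rightarrow> nat) \<Rightarrow> bool" where
  "proper_coloring G k c \<longleftrightarrow> c ` verts G \<subseteq> {..<k} \<and>
     (\<forall>u\<in>verts G. \<forall>v\<in>verts G. {u, v} \<in> edges G \<longrightarrow> c u \<noteq> c v)"

definition chromatic_number :: "('a, 'm) sgraph_scheme \<Rightarrow> nat" where
  "chromatic_number G = (LEAST k. \<exists>c. proper_coloring G k c)"

text \<open>
  Up to isomorphism every finite simple graph has its vertices in \<^typ>\<open>nat\<close>, so the host graphs
  range over \<^typ>\<open>nat sgraph\<close>. In \<^typ>\<open>enat\<close> the infimum of a nonempty set is its least element
  and the infimum of the empty set is \<open>\<infinity>\<close>.
\<close>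

definition order_chromatic_number :: "'a eograph \<Rightarrow> enat" where
  "order_chromatic_number H =
     Inf {enat (chromatic_number G) | G :: nat sgraph. simple_graph G \<and> \<not> can_avoid G H}"

text \<open>The vertex \<open>x\<^sub>i\<close> is represented by the number \<open>i\<close>.\<close>

definition D_edge_list :: "nat \<Rightarrow> nat set list" where
  "D_edge_list n = map (\<lambda>i. {1, i}) [2..<n + 1] @ map (\<lambda>i. {i, n}) [2..<n]"

definition D :: "nat \<Rightarrow> nat eograph" where
  "D n = \<lparr>verts = {1..n},
          edges = {{u, v} | u v. u \<in> {1..n} \<and> v \<in> {1..n} \<and> u \<noteq> v \<and> u \<in> {1, n}},
          eord = {(D_edge_list n ! i, D_edge_list n ! j) | i j. i \<le> j \<and> j < length (D_edge_list n)}\<rparr>"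

lemma length_D_edge_list: "2 \<le> n \<Longrightarrow> length (D_edge_list n) = 2 * n - 3"
  by (simp add: D_edge_list_def)

lemma distinct_D_edge_list: "distinct (D_edge_list n)"
  by (auto simp: D_edge_list_def distinct_map inj_on_def doubleton_eq_iff)

lemma set_D_edge_list:
  assumes "2 \<le> n"
  shows "set (D_edge_list n) = edges (D n)"
proof
  show "set (D_edge_list n) \<subseteq> edges (D n)"
  proof
    fix e assume "e \<in> set (D_edge_list n)"
    then consider i where "e = {1, i}" "2 \<le> i" "i \<le> n" | i where "e = {i, n}" "2 \<le> i" "i < n"
      by (auto simp: D_edge_list_def)
    then show "e \<in> edges (D n)"
    proof cases
      case 1
      with assms have "1 \<in> {1..n} \<and> i \<in> {1..n} \<and> 1 \<noteq> i \<and> 1 \<in> {1, n}" by auto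
      with 1(1) show ?thesis unfolding D_def by auto
    next
      case 2
      with assms have "n \<in> {1..n} \<and> i \<in> {1..n} \<and> n \<noteq> i \<and> n \<in> {1, n}" by auto
      with 2(1) show ?thesis unfolding D_def by (auto simp: insert_commute)
    qed
  qed
  show "edges (D n) \<subseteq> set (D_edge_list n)"
  proof
    fix e assume "e \<in> edges (D n)"
    then obtain u v where e: "e = {u, v}" "u \<in> {1..n}" "v \<in> {1..n}" "u \<noteq> v" "u = 1 \<or> u = n"
      by (auto simp: D_def)
    then consider "u = 1" "2 \<le> v" "v \<le> n" | "u = n" "v = 1" | "u = n" "2 \<le> v" "v < n"
      by fastforce
    then show "e \<in> set (D_edge_list n)"
    proof cases
      case 1
      then have "v \<in> set [2..<n + 1]" by auto
      then have "{1, v} \<in> set (D_edge_list n)"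
        unfolding D_edge_list_def set_append set_map by blast
      with 1 e(1) show ?thesis by simp
    next
      case 2
      have "n \<in> set [2..<n + 1]" using assms by simp
      with 2 e(1) show ?thesis unfolding D_edge_list_def by (auto simp: insert_commute)
    next
      case 3
      then have "v \<in> set [2..<n]" by simp
      with 3 e(1) show ?thesis unfolding D_edge_list_def by (auto simp: insert_commute)
    qed
  qed
qed

lemma edge_ordered_graph_D:
  assumes "2 \<le> n"
  shows "edge_ordered_graph (D n)"
proof -
  let ?L = "D_edge_list n"
  have r: "eord (D n) = {(?L ! i, ?L ! j) | i j. i \<le> j \<and> j < length ?L}"
    by (simp add: D_def)
  have eq: "?L ! i = ?L ! j \<longleftrightarrow> i = j" if "i < length ?L" "j < length ?L" for i j
    using that distinct_D_edge_list nth_eq_iff_index_eq by blast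
  have E: "edges (D n) = {?L ! i | i. i < length ?L}"
    unfolding set_D_edge_list[OF assms, symmetric] set_conv_nth ..
  have "simple_graph (D n)"
    by (auto simp: simple_graph_def D_def)
  moreover have "eord (D n) \<subseteq> edges (D n) \<times> edges (D n)"
    unfolding r E by fastforce
  moreover have "refl_on (edges (D n)) (eord (D n))"
    unfolding refl_on_def r E by fastforce
  moreover have "trans (eord (D n))"
  proof (rule transI)
    fix x y z assume "(x, y) \<in> eord (D n)" "(y, z) \<in> eord (D n)"
    then obtain i j k l where "x = ?L ! i" "y = ?L ! j" "i \<le> j" "j < length ?L"
      "y = ?L ! k" "z = ?L ! l" "k \<le> l" "l < length ?L"
      unfolding r by auto
    moreover from this have "j = k" using eq[of j k] by simp
    ultimately show "(x, z) \<in> eord (D n)" unfolding r by (auto intro: le_trans)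
  qed
  moreover have "antisym (eord (D n))"
  proof (rule antisymI)
    fix x y assume "(x, y) \<in> eord (D n)" "(y, x) \<in> eord (D n)"
    then obtain i j k l where *: "x = ?L ! i" "y = ?L ! j" "i \<le> j" "j < length ?L"
      "y = ?L ! k" "x = ?L ! l" "k \<le> l" "l < length ?L"
      unfolding r by blast
    then have "j = k" "i = l" using eq[of j k] eq[of i l] by simp_all
    with * show "x = y" by simp
  qed
  moreover have "total_on (edges (D n)) (eord (D n))"
  proof (rule total_onI)
    fix x y assume "x \<in> edges (D n)" "y \<in> edges (D n)"
    then obtain i j where "x = ?L ! i" "i < length ?L" "y = ?L ! j" "j < length ?L"
      unfolding E by auto
    then show "(x, y) \<in> eord (D n) \<or> (y, x) \<in> eord (D n)"
      unfolding r using nat_le_linear[of i j] by auto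
  qed
  ultimately show ?thesis
    by (simp add: edge_ordered_graph_def linear_order_on_def partial_order_on_def preorder_on_def)
qed

end

theory Submission
  imports Defs "HOL-Library.Product_Lexorder"
begin

text \<open>
  Let \<open>G\<close> be properly coloured with the numbers below \<open>2 ^ (n - 2)\<close>, and order its vertices
  linearly so that colours increase. The level of an edge is the position of the highest binary
  digit in which the colours of its ends differ. Order the edges by decreasing level, then by
  increasing upper end, then by decreasing lower end. Levels are ultrametric, and the edges of one
  level form a bipartite graph. Hence in a copy of \<open>D n\<close> the edges at \<open>x\<^sub>1\<close> all have the same level,
  and the edges \<open>x\<^sub>i x\<^sub>n\<close> with \<open>1 < i\<close> have smaller ones. The ties at \<open>x\<^sub>1\<close> force
  \<open>x\<^sub>2, \<dots>, x\<^sub>n\<close> to be monotone in the vertex order; were the levels of \<open>x\<^sub>i x\<^sub>n\<close> and \<open>x\<^sub>i\<^sub>+\<^sub>1 x\<^sub>n\<close> equal,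
  the tie at \<open>x\<^sub>n\<close> would force the opposite direction. So these \<open>n - 2\<close> levels strictly decrease
  below the level of \<open>x\<^sub>1 x\<^sub>n\<close>, but there are only \<open>n - 2\<close> levels in all.
\<close>

section \<open>Binary levels of pairs of numbers\<close>

text \<open>Digit positions count from 1, so level 0 means equality and numbers below
  \<open>2 ^ k\<close> have levels at most \<open>k\<close>.\<close>

definition level :: "nat \<Rightarrow> nat \<Rightarrow> nat" where
  "level a b = (LEAST j. a div 2 ^ j = b div 2 ^ j)"

lemma div_power_mono:
  fixes a b :: nat
  assumes "a div 2 ^ i = b div 2 ^ i" "i \<le> j"
  shows "a div 2 ^ j = b div 2 ^ j"
proof -
  have "x div 2 ^ j = x div 2 ^ i div 2 ^ (j - i)" for x :: nat
    using assms(2) by (simp flip: div_mult2_eq power_add)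
  with assms(1) show ?thesis by simp
qed

lemma level_le_iff: "level a b \<le> j \<longleftrightarrow> a div 2 ^ j = b div 2 ^ j"
proof
  \<comment> \<open>Both quotients vanish at the exponent \<open>a + b\<close>, so
    \<open>LEAST\<close> has a witness.\<close>
  have "a < 2 ^ (a + b)" "b < 2 ^ (a + b)"
    by (meson le_add1 le_add2 le_less_trans less_exp)+
  then have "a div 2 ^ (a + b) = b div 2 ^ (a + b)" by simp
  then have "a div 2 ^ level a b = b div 2 ^ level a b"
    unfolding level_def by (rule LeastI)
  then show "level a b \<le> j \<Longrightarrow> a div 2 ^ j = b div 2 ^ j"
    by (rule div_power_mono)
  show "a div 2 ^ j = b div 2 ^ j \<Longrightarrow> level a b \<le> j"
    unfolding level_def by (rule Least_le)
qed

lemma level_commute: "level a b = level b a"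
  unfolding level_def by (simp add: eq_commute)

lemma level_pos: "a \<noteq> b \<Longrightarrow> 0 < level a b"
  using level_le_iff[of a b 0] by simp

lemma level_le: "a < 2 ^ k \<Longrightarrow> b < 2 ^ k \<Longrightarrow> level a b \<le> k"
  by (simp add: level_le_iff)

lemma level_ultrametric: "level a c \<le> max (level a b) (level b c)"
  by (metis level_le_iff max.cobounded1 max.cobounded2)

text \<open>In the critical digit \<open>b\<close> differs from both \<open>a\<close> and
  \<open>c\<close>; a binary digit has only two values, so \<open>a\<close> and \<open>c\<close>
  share it, and all higher digits agree.\<close>

lemma level_binary:
  assumes "a \<noteq> b" "level a b = level b c"
  shows "level a c < level a b"
proof -
  obtain l where l: "level a b = Suc l"
    using level_pos[OF assms(1)] gr0_implies_Suc by blast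
  define x y z where "x = a div 2 ^ l" and "y = b div 2 ^ l" and "z = c div 2 ^ l"
  have half: "m div 2 ^ Suc l = m div 2 ^ l div 2" for m :: nat
    by (simp only: power_Suc2 div_mult2_eq)
  have "x div 2 = y div 2" "y div 2 = z div 2"
    using level_le_iff[of a b "Suc l"] level_le_iff[of b c "Suc l"] l assms(2)
    unfolding half x_def y_def z_def by simp_all
  moreover have "x \<noteq> y" "y \<noteq> z"
    using level_le_iff[of a b l] level_le_iff[of b c l] l assms(2)
    unfolding x_def y_def z_def by simp_all
  moreover have "m = 2 * (m div 2) \<or> m = 2 * (m div 2) + 1" for m :: nat
    by linarith
  ultimately have "x = z" by metis
  then show ?thesis
    using level_le_iff[of a c l] l unfolding x_def z_def by simp
qed

text \<open>Division by \<open>2 ^ level b c\<close> is monotone, merges \<open>b\<close> with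
  \<open>c\<close> and still separates \<open>a\<close> from \<open>c\<close>; so \<open>b\<close>
  lies on the same side of \<open>a\<close> as \<open>c\<close>.\<close>

lemma less_of_level_less:
  assumes "a < c" "level b c < level a c"
  shows "a < b"
proof (rule ccontr)
  define j where "j = level b c"
  assume "\<not> a < b"
  then have "b div 2 ^ j \<le> a div 2 ^ j" by (simp add: div_le_mono)
  moreover have "a div 2 ^ j \<le> c div 2 ^ j" using assms(1) by (simp add: div_le_mono)
  moreover have "b div 2 ^ j = c div 2 ^ j" using level_le_iff[of b c j] j_def by simp
  ultimately have "a div 2 ^ j = c div 2 ^ j" by simp
  then show False using level_le_iff[of a c j] assms(2) j_def by simp
qed

lemma greater_of_level_less:
  assumes "c < a" "level b c < level a c"
  shows "b < a"
proof (rule ccontr)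
  define j where "j = level b c"
  assume "\<not> b < a"
  then have "a div 2 ^ j \<le> b div 2 ^ j" by (simp add: div_le_mono)
  moreover have "c div 2 ^ j \<le> a div 2 ^ j" using assms(1) by (simp add: div_le_mono)
  moreover have "b div 2 ^ j = c div 2 ^ j" using level_le_iff[of b c j] j_def by simp
  ultimately have "a div 2 ^ j = c div 2 ^ j" by simp
  then show False using level_le_iff[of a c j] assms(2) j_def by simp
qed

section \<open>The key that orders the edges\<close>

text \<open>\<open>Min\<close> and \<open>Max\<close> pick out the two ends of an edge; the
  negations turn decreasing level and decreasing lower end into increasing lexicographic
  order.\<close>

definition edge_key :: "('a \<Rightarrow> nat) \<Rightarrow> ('a \<Rightarrow> nat) \<Rightarrow> 'a set \<Rightarrow> int \<times> int \<times> int" where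
  "edge_key c p e =
     (- int (level (Min (c ` e)) (Max (c ` e))), int (Max (p ` e)), - int (Min (p ` e)))"

lemma edge_key_pair:
  "edge_key c p {u, v} =
     (- int (level (c u) (c v)), int (max (p u) (p v)), - int (min (p u) (p v)))"
  by (auto simp: edge_key_def min_def max_def level_commute)

lemma inj_on_edge_key:
  assumes "inj_on p V" "\<And>e. e \<in> E \<Longrightarrow> e \<subseteq> V \<and> card e = 2"
  shows "inj_on (edge_key c p) E"
proof (rule inj_onI)
  fix d e assume "d \<in> E" "e \<in> E" and eq: "edge_key c p d = edge_key c p e"
  then obtain u v x y where uv: "d = {u, v}" "u \<in> V" "v \<in> V" and xy: "e = {x, y}" "x \<in> V" "y \<in> V"
    using assms(2) by (metis card_2_iff insert_subset)
  have "max (p u) (p v) = max (p x) (p y)" "min (p u) (p v) = min (p x) (p y)"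
    using eq unfolding uv xy edge_key_pair by simp_all
  then have "p u = p x \<and> p v = p y \<or> p u = p y \<and> p v = p x"
    by (auto simp: min_def max_def split: if_splits)
  then show "d = e" using assms(1) uv xy by (auto dest: inj_onD)
qed

section \<open>Levels in a copy of \<open>D n\<close>\<close>

text \<open>The combinatorial core, free of graphs and isomorphisms: \<open>y i\<close> stands for
  vertex \<open>i\<close> of a copy, and by \<open>mono\<close> the order given by \<open>p\<close>
  refines that of the colours.\<close>

lemma edge_key_not_D_like:
  fixes y :: "nat \<Rightarrow> 'a"
  assumes n: "2 \<le> n"
    and mono: "\<And>i j. i \<in> {1..n} \<Longrightarrow> j \<in> {1..n} \<Longrightarrow> p (y i) \<le> p (y j) \<Longrightarrow> c (y i) \<le> c (y j)"
    and bound: "\<And>i. i \<in> {1..n} \<Longrightarrow> c (y i) < 2 ^ (n - 2)"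
    and first: "\<And>i. 2 \<le> i \<Longrightarrow> i \<le> n \<Longrightarrow> c (y 1) \<noteq> c (y i)"
    and last: "\<And>i. 2 \<le> i \<Longrightarrow> i < n \<Longrightarrow> c (y i) \<noteq> c (y n)"
    and ord_first: "\<And>i j. 2 \<le> i \<Longrightarrow> i < j \<Longrightarrow> j \<le> n \<Longrightarrow>
      edge_key c p {y 1, y i} < edge_key c p {y 1, y j}"
    and ord_mid: "\<And>i. 2 \<le> i \<Longrightarrow> i < n \<Longrightarrow> edge_key c p {y 1, y n} < edge_key c p {y i, y n}"
    and ord_last: "\<And>i j. 2 \<le> i \<Longrightarrow> i < j \<Longrightarrow> j < n \<Longrightarrow>
      edge_key c p {y i, y n} < edge_key c p {y j, y n}"
  shows False
proof -
  define L where "L = level (c (y 1)) (c (y n))"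
  define l where "l i = level (c (y i)) (c (y n))" for i
  have L: "L \<le> n - 2"
    using bound n unfolding L_def by (intro level_le) simp_all
  \<comment> \<open>A larger key cannot have a larger level.\<close>
  have L_le: "L \<le> level (c (y 1)) (c (y i))" and l_le: "l i \<le> L" if "2 \<le> i" "i < n" for i
    using ord_first[OF that(1,2)] ord_mid[OF that]
    by (auto simp: edge_key_pair L_def l_def less_prod_def)
  \<comment> \<open>Equality would give two edges of level \<open>L\<close> meeting at
    \<open>y n\<close>, and \<open>level_binary\<close> would push \<open>{y 1, y i}\<close> below
    \<open>L\<close>.\<close>
  have l_less: "l i < L" if i: "2 \<le> i" "i < n" for i
  proof (rule ccontr)
    assume "\<not> l i < L"
    with l_le[OF i] have "level (c (y 1)) (c (y n)) = level (c (y n)) (c (y i))"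
      by (simp add: L_def l_def level_commute)
    then have "level (c (y 1)) (c (y i)) < L"
      using level_binary first n unfolding L_def by simp
    with L_le[OF i] show False by simp
  qed
  have first_level: "level (c (y 1)) (c (y i)) = L" if i: "2 \<le> i" "i \<le> n" for i
  proof (cases "i = n")
    case False
    with i have i: "2 \<le> i" "i < n" by auto
    have "level (c (y 1)) (c (y i)) \<le> max L (l i)"
      using level_ultrametric[of "c (y 1)" "c (y i)" "c (y n)"]
      by (simp add: L_def l_def level_commute)
    with l_less[OF i] L_le[OF i] show ?thesis by simp
  qed (simp add: L_def)
  \<comment> \<open>The order at \<open>y n\<close> already gives \<open>l j \<le> l i\<close>;
    equality would make its tie-breaking clash with that at \<open>y 1\<close>.\<close>
  have strict: "l j < l i" if ij: "2 \<le> i" "i < j" "j < n" for i j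
  proof (rule ccontr)
    assume "\<not> l j < l i"
    with ord_last[OF ij] have eq: "l i = l j"
      and key: "max (p (y i)) (p (y n)) < max (p (y j)) (p (y n)) \<or>
        max (p (y i)) (p (y n)) = max (p (y j)) (p (y n)) \<and>
        min (p (y j)) (p (y n)) < min (p (y i)) (p (y n))"
      by (auto simp: edge_key_pair l_def less_prod_def)
    have lev: "level (c (y 1)) (c (y h)) = L" if "h \<in> {i, j, n}" for h
      using that ij first_level by auto
    have keys: "max (p (y 1)) (p (y g)) < max (p (y 1)) (p (y h)) \<or>
        max (p (y 1)) (p (y g)) = max (p (y 1)) (p (y h)) \<and>
        min (p (y 1)) (p (y h)) < min (p (y 1)) (p (y g))"
      if "g < h" "g \<in> {i, j, n}" "h \<in> {i, j, n}" for g h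
      using ord_first[of g h] that ij lev[of g] lev[of h]
      by (auto simp: edge_key_pair less_prod_def)
    have mono': "p (y g) < p (y h)" if "c (y g) < c (y h)" "g \<in> {1, i, j, n}" "h \<in> {1, i, j, n}" for g h
      using mono[of h g] that ij by fastforce
    consider "c (y 1) < c (y n)" | "c (y n) < c (y 1)"
      using first[of n] n by fastforce
    then show False
    proof cases
      case 1
      \<comment> \<open>As \<open>l i\<close> and \<open>l j\<close> are below \<open>L\<close>,
        both vertices lie on the same side of \<open>y 1\<close> as \<open>y n\<close>.\<close>
      have "c (y 1) < c (y i)" "c (y 1) < c (y j)"
        using less_of_level_less[OF 1] l_less[of i] l_less[of j] ij unfolding L_def l_def by auto
      then have "p (y 1) < p (y i)" "p (y 1) < p (y j)" "p (y 1) < p (y n)"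
        using mono' 1 by auto
      \<comment> \<open>With \<open>y 1\<close> lowest, \<open>keys\<close> compares upper ends, so
        \<open>p\<close> increases along \<open>y i\<close>, \<open>y j\<close>, \<open>y n\<close>.
        Then \<open>y n\<close> is the upper end of both edges in \<open>key\<close>, which demands
        \<open>p (y j) < p (y i)\<close>.\<close>
      then show False
        using keys[of i j] keys[of j n] key ij by (simp add: max_def min_def split: if_splits)
    next
      case 2
      have "c (y i) < c (y 1)" "c (y j) < c (y 1)"
        using greater_of_level_less[OF 2] l_less[of i] l_less[of j] ij unfolding L_def l_def by auto
      then have "p (y i) < p (y 1)" "p (y j) < p (y 1)" "p (y n) < p (y 1)"
        using mono' 2 by auto
      \<comment> \<open>With \<open>y 1\<close> highest, \<open>keys\<close> compares lower ends, so
        \<open>p\<close> decreases along \<open>y i\<close>, \<open>y j\<close>, \<open>y n\<close>.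
        Now \<open>key\<close> compares upper ends and demands
        \<open>p (y i) < p (y j)\<close>.\<close>
      then show False
        using keys[of i j] keys[of j n] key ij by (simp add: max_def min_def split: if_splits)
    qed
  qed
  \<comment> \<open>Middle vertices start at index 2. At the last one, \<open>n - 1\<close>, the
    level is still positive, which forces \<open>L > n - 2\<close>.\<close>
  have count: "l (i + 2) + i < L" if "i + 2 < n" for i
    using that
  proof (induction i)
    case 0
    then show ?case using l_less[of 2] by (simp add: numeral_2_eq_2)
  next
    case (Suc i)
    then show ?case using strict[of "i + 2" "Suc i + 2"] by simp
  qed
  show False
  proof (cases "n = 2")
    \<comment> \<open>Without middle vertices the bound says \<open>L = 0\<close>, yet the ends of
      the single edge differ in colour.\<close>
    case True
    then show False using L level_pos[OF first[of n]] n by (simp add: L_def)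
  next
    case False
    then have "l (n - 1) + (n - 3) < L" "0 < l (n - 1)"
      using count[of "n - 3"] level_pos[OF last[of "n - 1"]] n
      by (simp_all add: l_def numeral_3_eq_3 numeral_2_eq_2 Suc_diff_Suc)
    then show False using L n False by simp
  qed
qed

section \<open>Comparisons in the edge order of \<open>D n\<close>\<close>

lemma D_edge_list_first:
  assumes "2 \<le> i" "i \<le> n"
  shows "D_edge_list n ! (i - 2) = {1, i}"
proof -
  obtain k where "i = k + 2" using assms(1) by (metis add.commute le_Suc_ex)
  then show ?thesis
    using assms(2) by (auto simp: D_edge_list_def nth_append simp del: upt_Suc)
qed

lemma D_edge_list_last:
  assumes "2 \<le> i" "i < n"
  shows "D_edge_list n ! (n - 1 + (i - 2)) = {i, n}"
proof -
  obtain k where "i = k + 2" using assms(1) by (metis add.commute le_Suc_ex)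
  then show ?thesis
    using assms(2) by (auto simp: D_edge_list_def nth_append simp del: upt_Suc)
qed

lemma eord_DI:
  "i \<le> j \<Longrightarrow> j < length (D_edge_list n) \<Longrightarrow> (D_edge_list n ! i, D_edge_list n ! j) \<in> eord (D n)"
  by (auto simp: D_def)

lemma eord_D_first:
  assumes "2 \<le> i" "i \<le> j" "j \<le> n"
  shows "({1, i}, {1, j}) \<in> eord (D n)"
  using eord_DI[of "i - 2" "j - 2" n] assms
  by (simp add: D_edge_list_first length_D_edge_list)

lemma eord_D_mid:
  assumes "2 \<le> i" "i < n"
  shows "({1, n}, {i, n}) \<in> eord (D n)"
  using eord_DI[of "n - 2" "n - 1 + (i - 2)" n] D_edge_list_last[OF assms] assms
  by (simp add: D_edge_list_first length_D_edge_list)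

lemma eord_D_last:
  assumes "2 \<le> i" "i \<le> j" "j < n"
  shows "({i, n}, {j, n}) \<in> eord (D n)"
  using eord_DI[of "n - 1 + (i - 2)" "n - 1 + (j - 2)" n]
    D_edge_list_last[of i n] D_edge_list_last[of j n] assms
  by (simp add: length_D_edge_list)

section \<open>From a colouring to an avoiding edge-ordering\<close>

lemma linear_order_on_key:
  fixes key :: "'a \<Rightarrow> 'b :: linorder"
  assumes "inj_on key E"
  shows "linear_order_on E {(d, e). d \<in> E \<and> e \<in> E \<and> key d \<le> key e}"
  using assms
  by (auto simp: linear_order_on_def partial_order_on_def preorder_on_def refl_on_def
      trans_def antisym_def total_on_def inj_on_def)

lemma can_avoid_D:
  fixes G :: "nat sgraph"
  assumes G: "simple_graph G" and c: "proper_coloring G (2 ^ (n - 2)) c" and n: "2 \<le> n"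
  shows "can_avoid G (D n)"
proof -
  \<comment> \<open>\<open>p\<close> encodes the pair (colour, vertex) in base \<open>N\<close>,
    which exceeds every vertex; hence it is injective on vertices and sorts by colour first. The
    inserted 0 covers the empty graph.\<close>
  define N where "N = Suc (Max (insert 0 (verts G)))"
  define p where "p v = c v * N + v" for v
  have fin: "finite (verts G)" and E: "\<And>e. e \<in> edges G \<Longrightarrow> e \<subseteq> verts G \<and> card e = 2"
    using G by (auto simp: simple_graph_def)
  have N: "v < N" if "v \<in> verts G" for v
    using that fin by (simp add: N_def le_imp_less_Suc)
  have p_div: "p v div N = c v" and p_mod: "p v mod N = v" if "v \<in> verts G" for v
    using N[OF that] by (simp_all add: p_def)
  have mono: "c u \<le> c v" if "u \<in> verts G" "v \<in> verts G" "p u \<le> p v" for u v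
    using div_le_mono[OF that(3), of N] that by (simp add: p_div)
  have "inj_on p (verts G)"
    by (metis inj_onI p_mod)
  then have inj: "inj_on (edge_key c p) (edges G)"
    using E by (rule inj_on_edge_key)
  define r where "r = {(d, e). d \<in> edges G \<and> e \<in> edges G \<and> edge_key c p d \<le> edge_key c p e}"
  have r_less: "edge_key c p d < edge_key c p e" if "(d, e) \<in> r" "d \<noteq> e" for d e
    using that inj by (auto simp: r_def inj_on_def order.order_iff_strict)
  have False
    if S: "eo_subgraph S \<lparr>verts = verts G, edges = edges G, eord = r\<rparr>"
      and iso: "eo_isomorphic S (D n)" for S
  proof -
    have sub: "verts S \<subseteq> verts G" "edges S \<subseteq> edges G" "eord S \<subseteq> r"
      using S by (auto simp: eo_subgraph_def)
    obtain f where f: "bij_betw f (verts S) {1..n}"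
      and f_edge: "\<And>u v. u \<in> verts S \<Longrightarrow> v \<in> verts S \<Longrightarrow>
        {u, v} \<in> edges S \<longleftrightarrow> {f u, f v} \<in> edges (D n)"
      and f_ord: "\<And>d e. d \<in> edges S \<Longrightarrow> e \<in> edges S \<Longrightarrow>
        (d, e) \<in> eord S \<longleftrightarrow> (f ` d, f ` e) \<in> eord (D n)"
      using iso unfolding eo_isomorphic_def by (auto simp: D_def)
    define y where "y = inv_into (verts S) f"
    have y: "y i \<in> verts S" "f (y i) = i" if "i \<in> {1..n}" for i
      using f that unfolding y_def bij_betw_def by (auto intro: inv_into_into f_inv_into_f)
    have y_edge: "{y i, y j} \<in> edges S" if "{i, j} \<in> edges (D n)" "i \<in> {1..n}" "j \<in> {1..n}" for i j
      using that f_edge y by simp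
    have y_less: "edge_key c p {y i, y j} < edge_key c p {y g, y h}"
      if "({i, j}, {g, h}) \<in> eord (D n)" "{i, j} \<noteq> {g, h}"
        "{i, j} \<in> edges (D n)" "{g, h} \<in> edges (D n)"
        "i \<in> {1..n}" "j \<in> {1..n}" "g \<in> {1..n}" "h \<in> {1..n}" for i j g h
    proof (rule r_less)
      have im: "f ` {y i, y j} = {i, j}" "f ` {y g, y h} = {g, h}"
        using y that by auto
      then show "({y i, y j}, {y g, y h}) \<in> r"
        using f_ord[of "{y i, y j}" "{y g, y h}"] y_edge that sub(3) by auto
      show "{y i, y j} \<noteq> {y g, y h}"
        using im that(2) by metis
    qed
    have first: "{1, i} \<in> edges (D n)" if "2 \<le> i" "i \<le> n" for i
    proof -
      have "1 \<in> {1..n} \<and> i \<in> {1..n} \<and> 1 \<noteq> i \<and> 1 \<in> {1, n}" using that by auto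
      then show ?thesis unfolding D_def by auto
    qed
    have last: "{i, n} \<in> edges (D n)" if "2 \<le> i" "i < n" for i
    proof -
      have "n \<in> {1..n} \<and> i \<in> {1..n} \<and> n \<noteq> i \<and> n \<in> {1, n}" using that by auto
      then show ?thesis unfolding D_def by (auto simp: insert_commute)
    qed
    have col: "c (y i) \<noteq> c (y j)" if "{i, j} \<in> edges (D n)" "i \<in> {1..n}" "j \<in> {1..n}" for i j
      using c y_edge[OF that] y(1)[OF that(2)] y(1)[OF that(3)] sub
      unfolding proper_coloring_def by blast
    show False
    proof (rule edge_key_not_D_like[OF n, of p y c])
      show "c (y i) \<le> c (y j)" if "i \<in> {1..n}" "j \<in> {1..n}" "p (y i) \<le> p (y j)" for i j
        using mono y that sub(1) by blast
      show "c (y i) < 2 ^ (n - 2)" if "i \<in> {1..n}" for i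
        using c y that sub(1) unfolding proper_coloring_def by blast
      show "c (y 1) \<noteq> c (y i)" if "2 \<le> i" "i \<le> n" for i
        using col[OF first] that by simp
      show "c (y i) \<noteq> c (y n)" if "2 \<le> i" "i < n" for i
        using col[OF last] that by simp
      show "edge_key c p {y 1, y i} < edge_key c p {y 1, y j}" if "2 \<le> i" "i < j" "j \<le> n" for i j
        using y_less[of 1 i 1 j] eord_D_first[of i j n] first that
        by (simp add: doubleton_eq_iff)
      show "edge_key c p {y 1, y n} < edge_key c p {y i, y n}" if "2 \<le> i" "i < n" for i
        using y_less[of 1 n i n] eord_D_mid[of i n] first last that
        by (simp add: doubleton_eq_iff)
      show "edge_key c p {y i, y n} < edge_key c p {y j, y n}" if "2 \<le> i" "i < j" "j < n" for i j
        using y_less[of i n j n] eord_D_last[of i j n] last that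
        by (simp add: doubleton_eq_iff)
    qed
  qed
  moreover have "linear_order_on (edges G) r"
    unfolding r_def using inj by (rule linear_order_on_key)
  ultimately show ?thesis unfolding can_avoid_def by blast
qed

lemma proper_coloring_chromatic_number:
  fixes G :: "nat sgraph"
  assumes "simple_graph G"
  shows "\<exists>c. proper_coloring G (chromatic_number G) c"
proof -
  \<comment> \<open>Vertices are numbers, so the identity is a colouring; this makes
    \<open>LEAST\<close> attained.\<close>
  have "proper_coloring G (Suc (Max (insert 0 (verts G)))) (\<lambda>v. v)"
    using assms by (auto simp: proper_coloring_def simple_graph_def le_imp_less_Suc)
  then show ?thesis unfolding chromatic_number_def by (intro LeastI) blast
qed

theorem theorem2p14:
  fixes n :: nat
  assumes "n \<ge> 2"
  shows "order_chromatic_number (D n) > enat (2 ^ (n - 2))"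
proof -
  have "2 ^ (n - 2) < chromatic_number G" if G: "simple_graph G" "\<not> can_avoid G (D n)"
    for G :: "nat sgraph"
  proof (rule ccontr)
    assume "\<not> 2 ^ (n - 2) < chromatic_number G"
    moreover obtain c where "proper_coloring G (chromatic_number G) c"
      using proper_coloring_chromatic_number G(1) by blast
    \<comment> \<open>Not all colours need occur, so the palette may be enlarged.\<close>
    ultimately have "proper_coloring G (2 ^ (n - 2)) c"
      unfolding proper_coloring_def by fastforce
    with G can_avoid_D assms show False by blast
  qed
  \<comment> \<open>A strict bound need not survive \<open>Inf\<close>, so it is passed through as a
    weak bound by the successor; this also covers the empty set.\<close>
  then have "enat (Suc (2 ^ (n - 2))) \<le> order_chromatic_number (D n)"
    unfolding order_chromatic_number_def by (intro Inf_greatest) (auto simp: Suc_le_eq)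
  then show ?thesis by (rule less_le_trans[rotated]) simp
qed

end
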